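(* Consider the three-parameter qubit model $$\rho_\theta=\frac12\begin{pmatrix}1+\theta_2&\theta_1e^{-i\theta_3}\\ \theta_1e^{i\theta_3}&1-\theta_2\end{pmatrix},\qquad \theta=(\theta_1,\theta_2,\theta_3),\quad \theta_1^2+\theta_2^2<1,\ \theta_1\neq0,$$ and let $C^H_\theta[\cdot]$ be its Holevo bound. Let $$G_\theta^{-1}=\begin{pmatrix}1-\theta_1^2 & -\theta_1\theta_2\\ -\theta_1\theta_2 & 1-\theta_2^2\end{pmatrix},\qquad \tilde G_\theta^{-1}=(1-\theta_1^2-\theta_2^2)\begin{pmatrix}1&0\\0&1\end{pmatrix},\qquad g_\theta^{33}=\frac1{\theta_1^2}.$$ Then for every block-diagonal weight matrix $W(3)=\begin{pmatrix}W&0\\0&w_3\end{pmatrix}$ with $W$ a real symmetric positive definite $2\times2$ matrix and $w_3>0$, $$C^H_\theta[W(3)]=\mathrm{Tr}\{WG_\theta^{-1}\}+w_3g_\theta^{33}+2\sqrt{w_3g_\theta^{33}}\,\sqrt{\mathrm{Tr}\{W(G_\theta^{-1}-\tilde G_\theta^{-1})\}}.$$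
   Context: For a smooth $k$-parameter family of density matrices $\rho_\theta$ on a finite-dimensional Hilbert space, with $\partial_i=\partial/\partial\theta_i$, let $\mathcal{X}_\theta$ be the set of $k$-tuples $\vec X=(X^1,\dots,X^k)$ of Hermitian operators such that $\mathrm{tr}(\rho_\theta X^i)=0$ for all $i$ and $\mathrm{tr}(\partial_i\rho_\theta\, X^j)=\delta_{ij}$ for all $i,j$. Let $Z_\theta[\vec X]$ be the $k\times k$ matrix with $(i,j)$ entry $\mathrm{tr}(\rho_\theta X^jX^i)$. For a real symmetric positive definite $k\times k$ matrix $W$, set $$h_\theta[\vec X|W]=\mathrm{Tr}\{W\,\mathrm{Re}\,Z_\theta[\vec X]\}+\mathrm{TrAbs}\{W\,\mathrm{Im}\,Z_\theta[\vec X]\},$$ where $\mathrm{Re}$ and $\mathrm{Im}$ are taken entrywise and $\mathrm{TrAbs}\{A\}$ is the sum of the absolute values of the eigenvalues of $A$ (with multiplicity). The Holevo bound is $C^H_\theta[W]=\min_{\vec X\in\mathcal{X}_\theta}h_\theta[\vec X|W]$. Here $k=3$. The matrices $G_\theta^{-1}$ and $\tilde G_\theta^{-1}$ are the inverse SLD and right-logarithmic-derivative (RLD) Fisher information matrices of the two-parameter model in which $\theta_3$ is known. *)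

theory Defs
  imports "HOL-Analysis.Analysis" "HOL-Computational_Algebra.Polynomial"
begin

section \<open>Matrices\<close>

definition hermitian :: "complex^'n^'n \<Rightarrow> bool" where
  "hermitian A \<longleftrightarrow> (\<forall>i j. A $ i $ j = cnj (A $ j $ i))"

definition sym_pos_def :: "real^'n^'n \<Rightarrow> bool" where
  "sym_pos_def W \<longleftrightarrow> transpose W = W \<and> (\<forall>x. x \<noteq> 0 \<longrightarrow> 0 < x \<bullet> (W *v x))"

definition Re_mat :: "complex^'n^'m \<Rightarrow> real^'n^'m" where
  "Re_mat A = (\<chi> i j. Re (A $ i $ j))"

definition Im_mat :: "complex^'n^'m \<Rightarrow> real^'n^'m" where
  "Im_mat A = (\<chi> i j. Im (A $ i $ j))"

definition complex_mat :: "real^'n^'m \<Rightarrow> complex^'n^'m" where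
  "complex_mat A = (\<chi> i j. complex_of_real (A $ i $ j))"

definition char_poly :: "complex^'n^'n \<Rightarrow> complex poly" where
  "char_poly A = det (mat [:0, 1:] - (\<chi> i j. [:A $ i $ j:]))"

text \<open>
  The eigenvalues with (algebraic) multiplicity are the multiset of roots of the
  characteristic polynomial. They are taken over the complex numbers: the real matrices
  to which this is applied below in general have non-real eigenvalues.
\<close>

definition tr_abs :: "complex^'n^'n \<Rightarrow> real" where
  "tr_abs A = (\<Sum>z\<in>#proots (char_poly A). cmod z)"


section \<open>The Holevo bound\<close>

definition partial_deriv :: "(real^'k \<Rightarrow> 'b::real_normed_vector) \<Rightarrow> real^'k \<Rightarrow> 'k \<Rightarrow> 'b" where
  "partial_deriv f \<theta> i = vector_derivative (\<lambda>t. f (\<theta> + t *\<^sub>R axis i 1)) (at 0)"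

definition unbiased_set ::
  "(real^'k \<Rightarrow> complex^'n^'n) \<Rightarrow> real^'k \<Rightarrow> ('k \<Rightarrow> complex^'n^'n) set" where
  "unbiased_set \<rho> \<theta> = {X. (\<forall>i. hermitian (X i)) \<and>
     (\<forall>i. trace (\<rho> \<theta> ** X i) = 0) \<and>
     (\<forall>i j. trace (partial_deriv \<rho> \<theta> i ** X j) = (if i = j then 1 else 0))}"

definition Z_mat ::
  "(real^'k \<Rightarrow> complex^'n^'n) \<Rightarrow> real^'k \<Rightarrow> ('k \<Rightarrow> complex^'n^'n) \<Rightarrow> complex^'k^'k" where
  "Z_mat \<rho> \<theta> X = (\<chi> i j. trace (\<rho> \<theta> ** X j ** X i))"

definition holevo_fun ::
  "(real^'k \<Rightarrow> complex^'n^'n) \<Rightarrow> real^'k \<Rightarrow> real^'k^'k \<Rightarrow> ('k \<Rightarrow> complex^'n^'n) \<Rightarrow> real" where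
  "holevo_fun \<rho> \<theta> W X =
     trace (W ** Re_mat (Z_mat \<rho> \<theta> X)) + tr_abs (complex_mat (W ** Im_mat (Z_mat \<rho> \<theta> X)))"

text \<open>
  The minimum of \<open>holevo_fun\<close> over \<open>unbiased_set\<close>. As \<open>LEAST\<close> is total, its value is
  meaningful only when a minimizer exists (see the following predicate).
\<close>

definition holevo_bound ::
  "(real^'k \<Rightarrow> complex^'n^'n) \<Rightarrow> real^'k \<Rightarrow> real^'k^'k \<Rightarrow> real" where
  "holevo_bound \<rho> \<theta> W = (LEAST c. c \<in> holevo_fun \<rho> \<theta> W ` unbiased_set \<rho> \<theta>)"

definition holevo_min_exists ::
  "(real^'k \<Rightarrow> complex^'n^'n) \<Rightarrow> real^'k \<Rightarrow> real^'k^'k \<Rightarrow> bool" where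
  "holevo_min_exists \<rho> \<theta> W \<longleftrightarrow>
     (\<exists>X\<in>unbiased_set \<rho> \<theta>. \<forall>Y\<in>unbiased_set \<rho> \<theta>. holevo_fun \<rho> \<theta> W X \<le> holevo_fun \<rho> \<theta> W Y)"


section \<open>The three-parameter qubit model\<close>

definition qubit_model :: "real^3 \<Rightarrow> complex^2^2" where
  "qubit_model \<theta> = (1/2) *\<^sub>R vector
     [vector [1 + complex_of_real (\<theta>$2), complex_of_real (\<theta>$1) * exp (- \<i> * complex_of_real (\<theta>$3))],
      vector [complex_of_real (\<theta>$1) * exp (\<i> * complex_of_real (\<theta>$3)), 1 - complex_of_real (\<theta>$2)]]"

definition G_inv :: "real^3 \<Rightarrow> real^2^2" where
  "G_inv \<theta> = vector
     [vector [1 - (\<theta>$1)\<^sup>2, - (\<theta>$1) * \<theta>$2],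
      vector [- (\<theta>$1) * \<theta>$2, 1 - (\<theta>$2)\<^sup>2]]"

definition G_tilde_inv :: "real^3 \<Rightarrow> real^2^2" where
  "G_tilde_inv \<theta> = (1 - (\<theta>$1)\<^sup>2 - (\<theta>$2)\<^sup>2) *\<^sub>R mat 1"

definition g33 :: "real^3 \<Rightarrow> real" where
  "g33 \<theta> = 1 / (\<theta>$1)\<^sup>2"

definition block_weight :: "real^2^2 \<Rightarrow> real \<Rightarrow> real^3^3" where
  "block_weight W w3 = vector
     [vector [W$1$1, W$1$2, 0],
      vector [W$2$1, W$2$2, 0],
      vector [0, 0, w3]]"

end

theory Submission
  imports Defs
begin

text \<open>
  In Bloch coordinates, a Hermitian 2x2 matrix is a real combination of the identity and the
  Pauli matrices. The three derivatives of the model are linearly independent and traceless,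
  so together with the centring condition they determine \<open>X\<close> completely: the unbiased set
  is a singleton and the Holevo bound is the value of the Holevo function at its only point.
  There \<open>W Im Z\<close> has characteristic polynomial \<open>x\<^sup>3 + r\<^sup>2 x\<close>, with roots \<open>0, i r, - i r\<close>.
\<close>

section \<open>Pauli coordinates: matrices of the form t I + v . sigma\<close>

definition pauli_comb :: "real \<Rightarrow> real^3 \<Rightarrow> complex^2^2" where
  "pauli_comb t v = vector
     [vector [Complex (t + v$3) 0, Complex (v$1) (- v$2)],
      vector [Complex (v$1) (v$2), Complex (t - v$3) 0]]"

lemma hermitian_pauli_comb: "hermitian (pauli_comb t v)"
  by (simp add: hermitian_def pauli_comb_def forall_2 complex_eq_iff)

lemma hermitian_2_cases:
  fixes A :: "complex^2^2"
  assumes "hermitian A"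
  obtains t v where "A = pauli_comb t v"
proof
  have "Im (A$1$1) = 0" "Im (A$2$2) = 0" "A$2$1 = cnj (A$1$2)"
    using assms unfolding hermitian_def by (metis Reals_cnj_iff complex_is_Real_iff)+
  then show "A = pauli_comb (Re (A$1$1 + A$2$2) / 2)
      (vector [Re (A$1$2), - Im (A$1$2), Re (A$1$1 - A$2$2) / 2])"
    by (simp add: pauli_comb_def vec_eq_iff forall_2 complex_eq_iff field_simps)
qed

lemma trace_pauli_comb_mult:
  "trace (pauli_comb s u ** pauli_comb t v) = of_real (2 * (s * t + u \<bullet> v))"
  by (simp add: pauli_comb_def trace_def matrix_matrix_mult_def sum_2 inner_vec_def sum_3
      complex_eq_iff algebra_simps)

text \<open>The rule (v . sigma)(w . sigma) = (v . w) I + i (v x w) . sigma yields the scalar triple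
  product, the sole source of imaginary entries in Z.\<close>

lemma trace_pauli_comb_mult3:
  "trace (pauli_comb r u ** pauli_comb s v ** pauli_comb t w) =
    Complex (2 * (r * s * t + r * (v \<bullet> w) + s * (u \<bullet> w) + t * (u \<bullet> v)))
      (2 * (u \<bullet> cross3 v w))"
  by (simp add: pauli_comb_def trace_def matrix_matrix_mult_def sum_2 inner_vec_def sum_3
      cross3_def complex_eq_iff algebra_simps)

lemma pauli_comb_has_vector_derivative:
  assumes "(f has_vector_derivative f') (at x within S)" "(g has_vector_derivative g') (at x within S)"
  shows "((\<lambda>x. pauli_comb (f x) (g x)) has_vector_derivative pauli_comb f' g') (at x within S)"
proof -
  \<comment> \<open>Real linearity in the pair of coordinates lets differentiation pass to the
    coordinates.\<close>
  have "linear (\<lambda>p. pauli_comb (fst p) (snd p))"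
    by (rule linearI)
      (simp_all add: pauli_comb_def vec_eq_iff forall_2 complex_eq_iff algebra_simps)
  then have "bounded_linear (\<lambda>p. pauli_comb (fst p) (snd p))"
    by (rule linear_conv_bounded_linear[THEN iffD1])
  from bounded_linear.has_vector_derivative[OF this has_vector_derivative_Pair[OF assms]]
  show ?thesis by simp
qed

lemma has_vector_derivative_vector_3:
  fixes f g h :: "real \<Rightarrow> real"
  assumes "(f has_vector_derivative f') F" "(g has_vector_derivative g') F"
    "(h has_vector_derivative h') F"
  shows "((\<lambda>x. vector [f x, g x, h x] :: real^3) has_vector_derivative vector [f', g', h']) F"
proof -
  have split: "(vector [a, b, c] :: real^3) = a *\<^sub>R axis 1 1 + b *\<^sub>R axis 2 1 + c *\<^sub>R axis 3 1"
    for a b c :: real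
    by (simp add: vec_eq_iff forall_3 axis_def)
  show ?thesis
    unfolding split
    by (intro has_vector_derivative_add
        bounded_linear.has_vector_derivative[OF bounded_linear_scaleR_left] assms)
qed

section \<open>Cylindrical coordinates in the Bloch ball\<close>

definition bloch_vec :: "real^3 \<Rightarrow> real^3" where
  "bloch_vec \<theta> = vector [\<theta>$1 * cos (\<theta>$3), \<theta>$1 * sin (\<theta>$3), \<theta>$2]"

text \<open>The radial, axial and azimuthal unit vectors. The tangent vectors of the Bloch vector
  are these, up to the signed lengths split off as \<open>frame_scale\<close>.\<close>

definition bloch_frame :: "real^3 \<Rightarrow> 3 \<Rightarrow> real^3" where
  "bloch_frame \<theta> i =
    (if i = 1 then vector [cos (\<theta>$3), sin (\<theta>$3), 0]
     else if i = 2 then vector [0, 0, 1]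
     else vector [- sin (\<theta>$3), cos (\<theta>$3), 0])"

definition frame_scale :: "real^3 \<Rightarrow> 3 \<Rightarrow> real" where
  "frame_scale \<theta> i = (if i = 3 then \<theta>$1 else 1)"

lemma bloch_frame_simps:
  "bloch_frame \<theta> 1 = vector [cos (\<theta>$3), sin (\<theta>$3), 0]"
  "bloch_frame \<theta> 2 = vector [0, 0, 1]"
  "bloch_frame \<theta> 3 = vector [- sin (\<theta>$3), cos (\<theta>$3), 0]"
  "frame_scale \<theta> 1 = 1" "frame_scale \<theta> 2 = 1" "frame_scale \<theta> 3 = \<theta>$1"
  by (simp_all add: bloch_frame_def frame_scale_def)

lemma qubit_model_eq: "qubit_model \<theta> = pauli_comb (1/2) ((1/2) *\<^sub>R bloch_vec \<theta>)"
proof -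
  have "exp (\<i> * complex_of_real x) = Complex (cos x) (sin x)"
    "exp (- (\<i> * complex_of_real x)) = Complex (cos x) (- sin x)" for x
    using cis_conv_exp[of x] cis_conv_exp[of "- x"] by (simp_all add: cis.code)
  then show ?thesis
    by (simp add: qubit_model_def pauli_comb_def bloch_vec_def vec_eq_iff forall_2
        complex_eq_iff field_simps)
qed

lemma partial_deriv_qubit_model:
  "partial_deriv qubit_model \<theta> i =
    pauli_comb 0 ((1/2 * frame_scale \<theta> i) *\<^sub>R bloch_frame \<theta> i)"
proof -
  define s where "s t = bloch_vec (\<theta> + t *\<^sub>R axis i 1)" for t
  have "(s has_vector_derivative (frame_scale \<theta> i *\<^sub>R bloch_frame \<theta> i)) (at 0)"
  proof -
    \<comment> \<open>Keeping the direction symbolic lets one differentiation cover all three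
      parameters.\<close>
    define a where "a j = (axis i 1 :: real^3) $ j" for j
    have "(s has_vector_derivative vector
        [a 1 * cos (\<theta>$3) - \<theta>$1 * (a 3 * sin (\<theta>$3)),
         a 1 * sin (\<theta>$3) + \<theta>$1 * (a 3 * cos (\<theta>$3)), a 2]) (at 0)"
      unfolding s_def bloch_vec_def
      by (intro has_vector_derivative_vector_3;
          unfold has_real_derivative_iff_has_vector_derivative[symmetric])
        (auto intro!: derivative_eq_intros simp: a_def)
    moreover have "vector
        [a 1 * cos (\<theta>$3) - \<theta>$1 * (a 3 * sin (\<theta>$3)),
         a 1 * sin (\<theta>$3) + \<theta>$1 * (a 3 * cos (\<theta>$3)), a 2] =
        frame_scale \<theta> i *\<^sub>R bloch_frame \<theta> i"
      using exhaust_3[of i]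
      by (auto simp: a_def axis_def bloch_frame_simps vec_eq_iff forall_3)
    ultimately show ?thesis by simp
  qed
  then have "((\<lambda>t. (1/2) *\<^sub>R s t) has_vector_derivative
      ((1/2) *\<^sub>R (frame_scale \<theta> i *\<^sub>R bloch_frame \<theta> i))) (at 0)"
    by (rule bounded_linear.has_vector_derivative[OF bounded_linear_scaleR_right])
  then have "((\<lambda>t. qubit_model (\<theta> + t *\<^sub>R axis i 1)) has_vector_derivative
      pauli_comb 0 ((1/2) *\<^sub>R (frame_scale \<theta> i *\<^sub>R bloch_frame \<theta> i))) (at 0)"
    unfolding qubit_model_eq s_def[symmetric]
    by (intro pauli_comb_has_vector_derivative has_vector_derivative_const)
  then show ?thesis
    by (simp add: partial_deriv_def vector_derivative_at)
qed

lemma bloch_frame_orthonormal: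
  "bloch_frame \<theta> i \<bullet> bloch_frame \<theta> j = (if i = j then 1 else 0)"
  using exhaust_3[of i] exhaust_3[of j]
  by (auto simp: bloch_frame_simps inner_vec_def sum_3 power2_eq_square[symmetric])

lemma mult_cos_sin_squared_add:
  fixes a x :: real
  shows "a * (cos x)\<^sup>2 + a * (sin x)\<^sup>2 = a"
  by (metis distrib_left mult.right_neutral sin_cos_squared_add2)

text \<open>Every vector is the sum of its components along the orthonormal frame.\<close>

lemma bloch_frame_ext:
  assumes "\<And>i. bloch_frame \<theta> i \<bullet> u = bloch_frame \<theta> i \<bullet> v"
  shows "u = v"
proof -
  have expand: "w = (\<Sum>i\<in>UNIV. (bloch_frame \<theta> i \<bullet> w) *\<^sub>R bloch_frame \<theta> i)" for w
    using mult_cos_sin_squared_add[of _ "\<theta>$3"]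
      by (simp add: sum_3 bloch_frame_simps vec_eq_iff forall_3 inner_vec_def
          algebra_simps power2_eq_square)
  show ?thesis using expand[of u] expand[of v] assms by simp
qed

section \<open>The unique locally unbiased triple\<close>

text \<open>The vector parts form the basis dual to the tangent vectors. The identity coefficient is
  minus the inner product of the vector part with the Bloch vector, as centring demands; it is 0 for
  the azimuthal direction, which is orthogonal to the Bloch vector.\<close>

definition unbiased_point :: "real^3 \<Rightarrow> 3 \<Rightarrow> complex^2^2" where
  "unbiased_point \<theta> j =
    pauli_comb (- (if j = 3 then 0 else \<theta>$j)) ((1 / frame_scale \<theta> j) *\<^sub>R bloch_frame \<theta> j)"

lemma bloch_vec_inner_frame:
  "bloch_vec \<theta> \<bullet> bloch_frame \<theta> j = (if j = 3 then 0 else \<theta>$j)"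
  using exhaust_3[of j] mult_cos_sin_squared_add[of _ "\<theta>$3"]
  by (auto simp: bloch_vec_def bloch_frame_simps inner_vec_def sum_3
      power2_eq_square mult.assoc)

lemma unbiased_set_qubit_model:
  assumes "\<theta>$1 \<noteq> 0"
  shows "unbiased_set qubit_model \<theta> = {unbiased_point \<theta>}"
proof -
  have nz: "frame_scale \<theta> j \<noteq> 0" for j
    using assms by (simp add: frame_scale_def)
  have "unbiased_point \<theta> \<in> unbiased_set qubit_model \<theta>"
    using nz assms unfolding unbiased_set_def
    by (auto simp: unbiased_point_def hermitian_pauli_comb qubit_model_eq
        partial_deriv_qubit_model trace_pauli_comb_mult bloch_vec_inner_frame
        bloch_frame_orthonormal frame_scale_def)
  moreover have "X = unbiased_point \<theta>" if X: "X \<in> unbiased_set qubit_model \<theta>" for X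
  proof
    fix j
    obtain t v where tv: "X j = pauli_comb t v"
      using X hermitian_2_cases unfolding unbiased_set_def by blast
    \<comment> \<open>The derivative conditions prescribe the components of \<open>v\<close> along
      the frame; the 1/2 in the derivative cancels the 2 of the trace formula.\<close>
    have v_frame: "frame_scale \<theta> i * (bloch_frame \<theta> i \<bullet> v) = (if i = j then 1 else 0)" for i
    proof -
      have "trace (partial_deriv qubit_model \<theta> i ** X j) = (if i = j then 1 else 0)"
        using X unfolding unbiased_set_def by blast
      then have "complex_of_real (frame_scale \<theta> i * (bloch_frame \<theta> i \<bullet> v)) =
          of_real (if i = j then 1 else 0)"
        by (simp add: partial_deriv_qubit_model tv trace_pauli_comb_mult)
      then show ?thesis using of_real_eq_iff by blast
    qed
    have "bloch_frame \<theta> i \<bullet> v = bloch_frame \<theta> i \<bullet> ((1 / frame_scale \<theta> j) *\<^sub>R bloch_frame \<theta> j)"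
      for i
      using nz[of i] nz[of j] v_frame[of i]
      by (cases "i = j") (simp_all add: bloch_frame_orthonormal field_simps)
    then have v: "v = (1 / frame_scale \<theta> j) *\<^sub>R bloch_frame \<theta> j"
      by (rule bloch_frame_ext)
    have "trace (qubit_model \<theta> ** X j) = 0"
      using X unfolding unbiased_set_def by blast
    then have "complex_of_real (t + bloch_vec \<theta> \<bullet> v) = of_real 0"
      by (simp add: qubit_model_eq tv trace_pauli_comb_mult)
    then have "t + bloch_vec \<theta> \<bullet> v = 0"
      using of_real_eq_iff by blast
    then have "t = - (bloch_vec \<theta> \<bullet> v)"
      by simp
    then show "X j = unbiased_point \<theta> j"
      by (simp add: tv v unbiased_point_def bloch_vec_inner_frame frame_scale_def split: if_splits)
  qed
  ultimately show ?thesis by blast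
qed

section \<open>The matrix Z at the unbiased triple\<close>

text \<open>With identity coefficients t_i = -(b . v_i), where b is the Bloch vector, the real part
  t_i t_j + v_i . v_j + t_j (b . v_i) + t_i (b . v_j) collapses to v_i . v_j - t_i t_j.\<close>

lemma Z_mat_unbiased_point:
  "Z_mat qubit_model \<theta> (unbiased_point \<theta>) $ i $ j =
    Complex ((if i = j then 1 / (frame_scale \<theta> i)\<^sup>2 else 0) - (if i = 3 \<or> j = 3 then 0 else \<theta>$i * \<theta>$j))
      ((bloch_vec \<theta> \<bullet> cross3 (bloch_frame \<theta> j) (bloch_frame \<theta> i)) / (frame_scale \<theta> i * frame_scale \<theta> j))"
  by (cases "i = 3"; cases "j = 3"; cases "i = j";
      simp add: Z_mat_def unbiased_point_def qubit_model_eq trace_pauli_comb_mult3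
      bloch_vec_inner_frame bloch_frame_orthonormal frame_scale_def cross_mult_left
      cross_mult_right power2_eq_square complex_eq_iff)

lemma Re_Z_mat_unbiased_point:
  "Re_mat (Z_mat qubit_model \<theta> (unbiased_point \<theta>)) = vector
    [vector [1 - (\<theta>$1)\<^sup>2, - (\<theta>$1 * \<theta>$2), 0],
     vector [- (\<theta>$1 * \<theta>$2), 1 - (\<theta>$2)\<^sup>2, 0],
     vector [0, 0, 1 / (\<theta>$1)\<^sup>2]]"
  by (simp add: Re_mat_def Z_mat_unbiased_point vec_eq_iff forall_3 frame_scale_def
      power2_eq_square)

text \<open>The cross product of the radial and axial vectors is azimuthal, hence orthogonal to the
  Bloch vector. So only entries pairing index 3 with 1 or 2 survive.\<close>

lemma Im_Z_mat_unbiased_point: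
  assumes "\<theta>$1 \<noteq> 0"
  shows "Im_mat (Z_mat qubit_model \<theta> (unbiased_point \<theta>)) = vector
    [vector [0, 0, - (\<theta>$2 / \<theta>$1)],
     vector [0, 0, 1],
     vector [\<theta>$2 / \<theta>$1, - 1, 0]]"
  using assms mult_cos_sin_squared_add[of _ "\<theta>$3"]
  by (simp add: Im_mat_def Z_mat_unbiased_point vec_eq_iff forall_3 bloch_frame_simps
      bloch_vec_def cross3_def inner_vec_def sum_3 field_simps power2_eq_square)

section \<open>Eigenvalues of the weighted imaginary part and the bound\<close>

lemma tr_abs_bordered:
  fixes a b c d r :: real
  assumes "a * c + b * d = - r\<^sup>2"
  shows "tr_abs (complex_mat (vector [vector [0, 0, a], vector [0, 0, b], vector [c, d, 0]]
    :: real^3^3)) = 2 * \<bar>r\<bar>"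
proof -
  let ?M = "complex_mat (vector [vector [0, 0, a], vector [0, 0, b], vector [c, d, 0]]) :: complex^3^3"
  have r: "\<i> * complex_of_real r * (\<i> * of_real r) = of_real (a * c + b * d)"
    by (simp add: assms power2_eq_square algebra_simps)
  have "char_poly ?M = [:0, - of_real (a * c + b * d), 0, 1:]"
    by (simp add: char_poly_def det_3 complex_mat_def mat_def algebra_simps)
  also have "\<dots> = [:- 0, 1:] * ([:- (\<i> * of_real r), 1:] * [:- (- (\<i> * of_real r)), 1:])"
    by (simp add: r[symmetric] del: of_real_add of_real_mult)
  finally have *: "char_poly ?M = [:- 0, 1:] * ([:- (\<i> * of_real r), 1:] * [:- (- (\<i> * of_real r)), 1:])" .
  show ?thesis
    unfolding tr_abs_def *
    \<comment> \<open>Blocking the expansion of products keeps the linear factors apart, so the root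
      multiset is the union of theirs and the moduli are 0, |r|, |r|.\<close>
    by (subst proots_mult; simp add: norm_mult del: mult_pCons_left mult_pCons_right)+
qed

lemma holevo_fun_unbiased_point:
  assumes "\<theta>$1 \<noteq> 0" "sym_pos_def W" "w3 > 0"
  shows "holevo_fun qubit_model \<theta> (block_weight W w3) (unbiased_point \<theta>) =
    trace (W ** G_inv \<theta>) + w3 * g33 \<theta>
      + 2 * sqrt (w3 * g33 \<theta>) * sqrt (trace (W ** (G_inv \<theta> - G_tilde_inv \<theta>)))"
proof -
  let ?q = "\<theta>$2 / \<theta>$1"
  define T where "T = trace (W ** (G_inv \<theta> - G_tilde_inv \<theta>))"
  have "transpose W $ 1 $ 2 = W $ 1 $ 2"
    using assms(2) by (simp add: sym_pos_def_def)
  then have sym: "W$2$1 = W$1$2"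
    by (simp add: transpose_def)
  have T: "T = W$1$1 * (\<theta>$2)\<^sup>2 - 2 * W$1$2 * \<theta>$1 * \<theta>$2 + W$2$2 * (\<theta>$1)\<^sup>2"
    by (simp add: T_def trace_def matrix_matrix_mult_def sum_2 G_inv_def G_tilde_inv_def mat_def
        sym algebra_simps)
  \<comment> \<open>The difference of the two inverse information matrices has rank one, so
    \<open>T\<close> is the quadratic form of \<open>W\<close> at a single vector, nonzero because
    its second entry is.\<close>
  have "T = vector [- \<theta>$2, \<theta>$1] \<bullet> (W *v vector [- \<theta>$2, \<theta>$1])"
    by (simp add: T inner_vec_def matrix_vector_mult_def sum_2 sym power2_eq_square algebra_simps)
  moreover have "(vector [- \<theta>$2, \<theta>$1] :: real^2) \<noteq> 0"
    using assms(1) by (simp add: vec_eq_iff forall_2)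
  ultimately have "T > 0"
    using assms(2) unfolding sym_pos_def_def by simp
  \<comment> \<open>Chosen so that 2 r is the last term of the claimed formula.\<close>
  define r where "r = sqrt (w3 * g33 \<theta>) * sqrt T"
  have g33: "g33 \<theta> > 0"
    using assms(1) by (simp add: g33_def)
  have r_sq: "r\<^sup>2 = w3 * g33 \<theta> * T"
    using \<open>T > 0\<close> assms(3) g33 by (simp add: r_def power_mult_distrib)
  \<comment> \<open>The hypothesis of \<open>tr_abs_bordered\<close> for the border entries of W Im
    Z computed next: their products sum to -w3 T / (theta_1)^2.\<close>
  have r: "(W$1$2 - W$1$1 * ?q) * (w3 * ?q) + (W$2$2 - W$1$2 * ?q) * (- w3) = - r\<^sup>2"
    using assms(1) unfolding r_sq by (simp add: g33_def T field_simps power2_eq_square)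
  have "block_weight W w3 ** Im_mat (Z_mat qubit_model \<theta> (unbiased_point \<theta>)) =
      vector [vector [0, 0, W$1$2 - W$1$1 * ?q], vector [0, 0, W$2$2 - W$1$2 * ?q],
        vector [w3 * ?q, - w3, 0]]"
    by (simp add: Im_Z_mat_unbiased_point[OF assms(1)] block_weight_def matrix_matrix_mult_def
        vec_eq_iff forall_3 sum_3 sym)
  then have "tr_abs (complex_mat (block_weight W w3 **
      Im_mat (Z_mat qubit_model \<theta> (unbiased_point \<theta>)))) = 2 * \<bar>r\<bar>"
    using tr_abs_bordered[OF r] by simp
  moreover have "r \<ge> 0"
    using \<open>T > 0\<close> assms(3) g33 by (simp add: r_def)
  moreover have "trace (block_weight W w3 ** Re_mat (Z_mat qubit_model \<theta> (unbiased_point \<theta>))) =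
      trace (W ** G_inv \<theta>) + w3 * g33 \<theta>"
    by (simp add: Re_Z_mat_unbiased_point block_weight_def matrix_matrix_mult_def trace_def
        sum_3 sum_2 G_inv_def g33_def)
  ultimately show ?thesis
    by (simp add: holevo_fun_def r_def T_def)
qed

theorem mainTheorem5:
  fixes \<theta> :: "real^3" and W :: "real^2^2" and w3 :: real
  assumes "(\<theta>$1)\<^sup>2 + (\<theta>$2)\<^sup>2 < 1" and "\<theta>$1 \<noteq> 0"
    and "sym_pos_def W" and "w3 > 0"
  shows "holevo_min_exists qubit_model \<theta> (block_weight W w3) \<and>
    holevo_bound qubit_model \<theta> (block_weight W w3) =
      trace (W ** G_inv \<theta>) + w3 * g33 \<theta>
      + 2 * sqrt (w3 * g33 \<theta>) * sqrt (trace (W ** (G_inv \<theta> - G_tilde_inv \<theta>)))"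
  \<comment> \<open>Over a singleton the only value is attained and least, which settles both
    existence and the \<open>LEAST\<close>.\<close>
  unfolding holevo_min_exists_def holevo_bound_def unbiased_set_qubit_model[OF assms(2)]
  using holevo_fun_unbiased_point[OF assms(2-4)] by (auto intro: Least_equality)

end
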